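(* Let $d,k,n\ge 1$ be integers, let $K\subset\mathbb{R}^d$ be a $0$-symmetric convex body, and let $\|\cdot\|$ be the norm on $\mathbb{R}^d$ with unit ball $K$. Let $A=\{a_i^j\}$ ($j\in\{1,\ldots,k\}$, $i\in\{1,\ldots,n\}$) be a $k\times n$ matrix with entries $a_i^j\in K$ such that $\sum_{j=1}^k\sum_{i=1}^n a_i^j=0$. Then there is a row-permuted copy $C=\{c_i^j\}$ of $A$ such that \[ \Bigl\|\sum_{j=1}^k\sum_{i=1}^m c_i^j\Bigr\|\le \min\{dk,\,4d-2\}\quad\text{for every } m\in\{1,\ldots,n\}. \]
   Context: A $0$-symmetric convex body in $\mathbb{R}^d$ is a compact convex set $K$ with non-empty interior and $K=-K$; it defines the norm $\|x\|=\min\{t\ge 0: x\in tK\}$, so $\|x\|\le 1$ if and only if $x\in K$. The entry $a_i^j\in\mathbb{R}^d$ of a $k\times n$ matrix $A=\{a_i^j\}$ is in row $j$ and column $i$. A row-permuted copy of $A$ is a $k\times n$ matrix $C=\{c_i^j\}$ such that for every $j\in\{1,\ldots,k\}$ the sequence $c_1^j,\ldots,c_n^j$ is a rearrangement of $a_1^j,\ldots,a_n^j$; that is, there are permutations $\pi_1,\ldots,\pi_k$ of $\{1,\ldots,n\}$ (one for each row, possibly different) with $c_i^j=a_{\pi_j(i)}^j$ for all $i,j$. *)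

theory Defs
  imports "HOL-Analysis.Analysis" "HOL-Combinatorics.Permutations"
begin

definition symmetric_convex_body :: "(real ^ 'd) set \<Rightarrow> bool" where
  "symmetric_convex_body K \<longleftrightarrow>
     compact K \<and> convex K \<and> interior K \<noteq> {} \<and> K = uminus ` K"

text \<open>The norm with unit ball \<open>K\<close>. The set on the right has a least element whenever
  \<open>K\<close> is a symmetric convex body (lemma \<open>body_norm_attained\<close> below);
  for other sets the value is unspecified.\<close>

definition body_norm :: "(real ^ 'd) set \<Rightarrow> real ^ 'd \<Rightarrow> real" where
  "body_norm K x = (LEAST t. 0 \<le> t \<and> x \<in> (\<lambda>y. t *\<^sub>R y) ` K)"

text \<open>A \<open>k \<times> n\<close> matrix is a function \<open>A\<close> of which only the values \<open>A j i\<close> with row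
  index \<open>j \<in> {1..k}\<close> and column index \<open>i \<in> {1..n}\<close> matter; \<open>A j i\<close> is the entry
  \<open>a\<^sub>i\<^sup>j\<close>.\<close>

definition row_permuted_copy ::
    "nat \<Rightarrow> nat \<Rightarrow> (nat \<Rightarrow> nat \<Rightarrow> 'a) \<Rightarrow> (nat \<Rightarrow> nat \<Rightarrow> 'a) \<Rightarrow> bool" where
  "row_permuted_copy k n A C \<longleftrightarrow>
     (\<exists>\<pi> :: nat \<Rightarrow> nat \<Rightarrow> nat. \<forall>j\<in>{1..k}. \<pi> j permutes {1..n} \<and>
        (\<forall>i\<in>{1..n}. C j i = A j (\<pi> j i)))"

lemma symmetric_convex_body_zero_interior:
  fixes K :: "(real ^ 'd) set"
  assumes "symmetric_convex_body K"
  shows "0 \<in> interior K"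
proof -
  have cK: "convex K" and sK: "K = uminus ` K"
    using assms by (auto simp: symmetric_convex_body_def)
  obtain x where x: "x \<in> interior K"
    using assms by (auto simp: symmetric_convex_body_def)
  have "interior K = uminus ` interior K"
    using interior_negations[of K] sK by simp
  then have mx: "- x \<in> interior K" using x by blast
  have "(1/2) *\<^sub>R x + (1/2) *\<^sub>R (- x) \<in> interior K"
    using convexD[OF convex_interior[OF cK] x mx, of "1/2" "1/2"] by simp
  then show ?thesis by simp
qed

lemma body_norm_attained:
  fixes K :: "(real ^ 'd) set"
  assumes K: "symmetric_convex_body K"
  shows "0 \<le> body_norm K x \<and> x \<in> (\<lambda>y. body_norm K x *\<^sub>R y) ` K"
    and "\<And>t. 0 \<le> t \<Longrightarrow> x \<in> (\<lambda>y. t *\<^sub>R y) ` K \<Longrightarrow> body_norm K x \<le> t"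
proof -
  define S where "S = {t. 0 \<le> t \<and> x \<in> (\<lambda>y. t *\<^sub>R y) ` K}"
  have cK: "compact K" using K by (auto simp: symmetric_convex_body_def)
  obtain e where e: "e > 0" "ball 0 e \<subseteq> K"
    using symmetric_convex_body_zero_interior[OF K] by (meson mem_interior)
  define T where "T = 2 * (norm x + 1) / e"
  have T: "T > 0" unfolding T_def using e(1) by (simp add: add_nonneg_pos)
  have "norm x < e * T"
    unfolding T_def using e(1) by (simp, smt (verit) norm_ge_zero)
  then have "norm ((1 / T) *\<^sub>R x) < e"
    using T by (simp add: pos_divide_less_eq)
  then have "(1 / T) *\<^sub>R x \<in> K" using e(2) by auto
  then have "T \<in> S" using T by (auto simp: S_def intro!: image_eqI[of _ _ "(1 / T) *\<^sub>R x"])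
  have comp: "compact (({0..T} \<times> K) \<inter> (\<lambda>(t, y). t *\<^sub>R y) -` {x})"
  proof -
    have "continuous_on ({0..T} \<times> K) (\<lambda>(t, y). t *\<^sub>R y)"
      by (auto simp: case_prod_unfold intro!: continuous_intros)
    moreover have "compact ({0..T} \<times> K)" using cK by (intro compact_Times) auto
    ultimately have "closed (({0..T} \<times> K) \<inter> (\<lambda>(t, y). t *\<^sub>R y) -` {x})"
      by (intro continuous_closed_preimage compact_imp_closed) auto
    then have "compact (({0..T} \<times> K) \<inter> (({0..T} \<times> K) \<inter> (\<lambda>(t, y). t *\<^sub>R y) -` {x}))"
      using \<open>compact ({0..T} \<times> K)\<close> by (rule compact_Int_closed[rotated])
    then show ?thesis by simp
  qed
  have "S \<inter> {..T} = fst ` (({0..T} \<times> K) \<inter> (\<lambda>(t, y). t *\<^sub>R y) -` {x})"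
    by (force simp: S_def)
  moreover have "compact (fst ` (({0..T} \<times> K) \<inter> (\<lambda>(t, y). t *\<^sub>R y) -` {x}))"
    by (intro compact_continuous_image comp continuous_intros)
  ultimately have "compact (S \<inter> {..T})" by simp
  moreover have "S \<inter> {..T} \<noteq> {}" using \<open>T \<in> S\<close> by auto
  ultimately obtain m where m: "m \<in> S \<inter> {..T}" "\<And>t. t \<in> S \<inter> {..T} \<Longrightarrow> m \<le> t"
    by (meson compact_attains_inf)
  have least: "m \<le> t" if "t \<in> S" for t
    using m that by (cases "t \<le> T") auto
  have "body_norm K x = m"
    unfolding body_norm_def
    by (rule Least_equality) (use m(1) least in \<open>auto simp: S_def\<close>)
  then show "0 \<le> body_norm K x \<and> x \<in> (\<lambda>y. body_norm K x *\<^sub>R y) ` K"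
    and "\<And>t. 0 \<le> t \<Longrightarrow> x \<in> (\<lambda>y. t *\<^sub>R y) ` K \<Longrightarrow> body_norm K x \<le> t"
    using m(1) least by (auto simp: S_def)
qed

lemma body_norm_le_one_iff:
  fixes K :: "(real ^ 'd) set"
  assumes K: "symmetric_convex_body K"
  shows "body_norm K x \<le> 1 \<longleftrightarrow> x \<in> K"
proof
  assume "x \<in> K"
  then show "body_norm K x \<le> 1"
    by (intro body_norm_attained(2)[OF K]) auto
next
  assume le: "body_norm K x \<le> 1"
  obtain y where y: "y \<in> K" "x = body_norm K x *\<^sub>R y"
    using body_norm_attained(1)[OF K, of x] by auto
  have "0 \<in> K" using symmetric_convex_body_zero_interior[OF K] interior_subset by blast
  moreover have "convex K" using K by (simp add: symmetric_convex_body_def)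
  ultimately have "body_norm K x *\<^sub>R y + (1 - body_norm K x) *\<^sub>R 0 \<in> K"
    using y(1) le body_norm_attained(1)[OF K, of x] by (intro convexD) auto
  then show "x \<in> K" using y(2) by simp
qed

end

theory Submission
  imports Defs
begin

text \<open>
  Write \<open>d\<close> for the dimension. Instead of choosing columns, choose weights: give every cell
  of the matrix a weight in \<open>[0, 1]\<close> so that every row has total weight \<open>p\<close> and the weighted
  sum of all entries is \<open>0\<close> (\<open>balanced\<close>). The constant weight \<open>p / n\<close> does this, so
  fractionally all prefix sums can be made to vanish. The price of rounding is
  controlled by looking at extreme points: if the numbers of fractional cells and of rows
  containing one are \<open>f\<close> and \<open>r\<close>, then at an extreme point \<open>f \<le> r + d\<close>, since the constraints seen
  by the fractional cells are \<open>r\<close> row sums and \<open>d\<close> coordinates (\<open>balanced_few_fractional\<close>).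
  For an integer \<open>p\<close>, each of the \<open>r\<close> rows carries a positive integer amount of weight
  on its fractional cells, hence at least \<open>1\<close>, and so the support has at most \<open>k p + d\<close>
  cells in total (\<open>support_of_few_fractional\<close>), which is only \<open>d\<close> more than the least number
  possible.

  Multiplying weights with row sums \<open>p\<close> by \<open>(p - 1) / p\<close> and passing to an extreme point does not
  enlarge the support. Starting from the constant \<open>1\<close> this gives balanced weights \<open>w\<^sub>n, \<dots>, w\<^sub>0\<close> with
  nested supports (\<open>nested_balanced_weightings\<close>). Reorder each row so that all these supports
  become initial segments of it (\<open>permutation_following_chain\<close>), and let \<open>V\<close> be the set of cells
  moved into the first \<open>m\<close> columns. As the entries weighted by \<open>w\<^sub>p\<close> sum to \<open>0\<close>, the sum over \<open>V\<close> has
  norm at most the \<open>L\<^sup>1\<close> distance between \<open>w\<^sub>p\<close> and the indicator of \<open>V\<close>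
  (\<open>body_norm_sum_le_distance_to_balanced\<close>). Two choices of \<open>p\<close> give the two bounds.

  For \<open>p = m\<close> the set \<open>V\<close> lies inside the support, and both \<open>V\<close> and \<open>w\<^sub>m\<close> have total mass \<open>k m\<close> while
  the support has at most \<open>k m + d\<close> cells; the distance is at most \<open>2 d \<le> 4 d - 2\<close>.
  For \<open>p = m - d\<close> each row of the support has at most \<open>p + d = m\<close> cells, so \<open>V\<close> contains the
  support and the distance is \<open>k m - k p = d k\<close>. If \<open>m < d\<close>, take \<open>p = 0\<close>: the support is empty
  and the distance is \<open>k m \<le> d k\<close>.
\<close>

section \<open>Linear dependences with vanishing row sums\<close>

text \<open>The dependence is one of an indexed family: repeated vectors have to count with
  multiplicity, because different cells of a matrix may carry equal entries.\<close>

lemma family_dependent_of_card_gt_DIM: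
  fixes g :: "'i \<Rightarrow> 'a::euclidean_space"
  assumes "finite S" and "card S > DIM('a)"
  shows "\<exists>c. (\<exists>x\<in>S. c x \<noteq> 0) \<and> (\<Sum>x\<in>S. c x *\<^sub>R g x) = 0"
proof (cases "inj_on g S")
  case True
  then have "card (g ` S) > DIM('a)" using assms by (simp add: card_image)
  then have "dependent (g ` S)" using assms(1) by (intro dependent_biggerset) auto
  then obtain c where c: "\<exists>y\<in>g ` S. c y \<noteq> 0" "(\<Sum>y\<in>g ` S. c y *\<^sub>R y) = 0"
    using assms(1) dependent_finite[of "g ` S"] by auto
  have "(\<Sum>x\<in>S. c (g x) *\<^sub>R g x) = 0"
    using c(2) by (simp add: sum.reindex[OF True])
  then show ?thesis using c(1) by (intro exI[of _ "c \<circ> g"]) auto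
next
  case False
  then obtain x y where xy: "x \<in> S" "y \<in> S" "x \<noteq> y" "g x = g y"
    by (auto simp: inj_on_def)
  define c :: "'i \<Rightarrow> real" where "c z = (if z = x then 1 else 0) - (if z = y then 1 else 0)" for z
  have "(\<Sum>z\<in>S. c z *\<^sub>R g z)
      = (\<Sum>z\<in>S. if z = x then g z else 0) - (\<Sum>z\<in>S. if z = y then g z else 0)"
    unfolding sum_subtractf[symmetric] by (rule sum.cong) (auto simp: c_def)
  also have "\<dots> = 0" using xy assms(1) by simp
  finally show ?thesis using xy by (intro exI[of _ c]) (auto simp: c_def intro!: bexI[of _ x])
qed

text \<open>The map \<open>\<rho>\<close> assigns to every cell its row. Fixing one representative cell per row, any
  coefficients on the remaining cells extend uniquely to coefficients with vanishing row sums,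
  and the resulting combination of the \<open>v x\<close> is one of the differences between \<open>v x\<close>
  and the vector at the representative of the row of \<open>x\<close>. There are more than \<open>DIM('a)\<close>
  such differences.\<close>

lemma dependence_with_zero_row_sums:
  fixes v :: "'i \<Rightarrow> 'a::euclidean_space" and \<rho> :: "'i \<Rightarrow> 'r"
  assumes fin: "finite F" and big: "card F > card (\<rho> ` F) + DIM('a)"
  shows "\<exists>u. (\<exists>x\<in>F. u x \<noteq> 0) \<and> (\<forall>r. (\<Sum>x\<in>{x\<in>F. \<rho> x = r}. u x) = 0)
           \<and> (\<Sum>x\<in>F. u x *\<^sub>R v x) = 0"
proof -
  obtain h where h: "\<And>r. r \<in> \<rho> ` F \<Longrightarrow> h r \<in> F \<and> \<rho> (h r) = r"
    by (metis image_iff)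
  \<comment> \<open>\<open>B\<close> consists of the representatives.\<close>
  define B where "B = h ` \<rho> ` F"
  have B: "B \<subseteq> F" using h by (auto simp: B_def)
  have "card B \<le> card (\<rho> ` F)" unfolding B_def using fin by (simp add: card_image_le)
  moreover have "card (F - B) = card F - card B"
    using B fin by (simp add: card_Diff_subset finite_subset)
  ultimately have "card (F - B) > DIM('a)" using big by linarith
  from family_dependent_of_card_gt_DIM[OF _ this, of "\<lambda>x. v x - v (h (\<rho> x))"] fin
  obtain c where c: "\<exists>x\<in>F - B. c x \<noteq> 0"
      "(\<Sum>x\<in>F - B. c x *\<^sub>R (v x - v (h (\<rho> x)))) = 0" by auto
  define u where "u x = (if x \<in> B then - (\<Sum>y\<in>{y\<in>F - B. \<rho> y = \<rho> x}. c y) else c x)" for x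
  have nz: "\<exists>x\<in>F. u x \<noteq> 0" using c(1) by (auto simp: u_def)
  have hB: "h (\<rho> x) = x" if "x \<in> B" for x
    using that h by (auto simp: B_def)
  have rows: "(\<Sum>x\<in>{x\<in>F. \<rho> x = r}. u x) = 0" for r
  proof (cases "r \<in> \<rho> ` F")
    case True
    then have "{x\<in>F. \<rho> x = r} = insert (h r) {x\<in>F - B. \<rho> x = r}"
      using h B hB by (auto simp: B_def)
    moreover have "h r \<in> B" using True by (auto simp: B_def)
    ultimately have "(\<Sum>x\<in>{x\<in>F. \<rho> x = r}. u x) = u (h r) + (\<Sum>x\<in>{x\<in>F - B. \<rho> x = r}. u x)"
      using fin by simp
    also have "(\<Sum>x\<in>{x\<in>F - B. \<rho> x = r}. u x) = (\<Sum>x\<in>{x\<in>F - B. \<rho> x = r}. c x)"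
      by (rule sum.cong) (auto simp: u_def)
    finally show ?thesis using \<open>h r \<in> B\<close> h[OF True] by (simp add: u_def)
  next
    case False
    then have none: "{x\<in>F. \<rho> x = r} = {}" by auto
    show ?thesis unfolding none by simp
  qed
  have img: "\<rho> ` (F - B) \<subseteq> \<rho> ` F" by auto
  have "(\<Sum>x\<in>B. u x *\<^sub>R v x) = (\<Sum>r\<in>\<rho> ` F. u (h r) *\<^sub>R v (h r))"
    unfolding B_def by (rule sum.reindex_cong[of h]) (auto intro!: inj_onI dest: h, metis h imageI)
  also have "\<dots> = (\<Sum>r\<in>\<rho> ` F. - (\<Sum>x\<in>{x\<in>F - B. \<rho> x = r}. c x *\<^sub>R v (h (\<rho> x))))"
  proof (rule sum.cong[OF refl])
    fix r assume r: "r \<in> \<rho> ` F"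
    then have "h r \<in> B" by (auto simp: B_def)
    then show "u (h r) *\<^sub>R v (h r) = - (\<Sum>x\<in>{x\<in>F - B. \<rho> x = r}. c x *\<^sub>R v (h (\<rho> x)))"
      using h[OF r] by (simp add: u_def scaleR_sum_left)
  qed
  also have "\<dots> = - (\<Sum>x\<in>F - B. c x *\<^sub>R v (h (\<rho> x)))"
    unfolding sum_negf using fin img by (subst sum.group) auto
  finally have "(\<Sum>x\<in>B. u x *\<^sub>R v x) = - (\<Sum>x\<in>F - B. c x *\<^sub>R v (h (\<rho> x)))" .
  moreover have "(\<Sum>x\<in>F - B. u x *\<^sub>R v x) = (\<Sum>x\<in>F - B. c x *\<^sub>R v x)"
    by (rule sum.cong) (auto simp: u_def)
  moreover have "(\<Sum>x\<in>F. u x *\<^sub>R v x) = (\<Sum>x\<in>F - B. u x *\<^sub>R v x) + (\<Sum>x\<in>B. u x *\<^sub>R v x)"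
    using sum.subset_diff[OF B fin] .
  ultimately have "(\<Sum>x\<in>F. u x *\<^sub>R v x) = 0"
    using c(2) by (simp add: scaleR_diff_right sum_subtractf)
  then show ?thesis using nz rows by blast
qed

section \<open>Balanced weights with small support\<close>

lemma move_to_boundary_of_cube:
  fixes w u :: "'i \<Rightarrow> real"
  assumes fin: "finite F" and frac: "\<And>x. x \<in> F \<Longrightarrow> 0 < w x \<and> w x < 1" and u: "\<exists>x\<in>F. u x \<noteq> 0"
  shows "\<exists>t. (\<forall>x\<in>F. 0 \<le> w x + t * u x \<and> w x + t * u x \<le> 1) \<and>
             (\<exists>x\<in>F. w x + t * u x = 0 \<or> w x + t * u x = 1)"
proof -
  \<comment> \<open>\<open>\<tau> x\<close> is the time at which coordinate \<open>x\<close> reaches \<open>0\<close> or \<open>1\<close>; the first such time is taken.\<close>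
  define \<tau> where "\<tau> x = (if u x > 0 then (1 - w x) / u x else w x / (- u x))" for x
  define G where "G = {x\<in>F. u x \<noteq> 0}"
  have G: "finite G" "G \<noteq> {}" using fin u by (auto simp: G_def)
  define t where "t = Min (\<tau> ` G)"
  have t_le: "t \<le> \<tau> x" if "x \<in> G" for x
    unfolding t_def using G that by auto
  have "t \<in> \<tau> ` G" unfolding t_def using G by (intro Min_in) auto
  then obtain z where z: "z \<in> G" "t = \<tau> z" by auto
  have t0: "t > 0" using z frac[of z] by (auto simp: \<tau>_def G_def divide_simps)
  have "0 \<le> w x + t * u x \<and> w x + t * u x \<le> 1" if x: "x \<in> F" for x
  proof (cases "u x" "0::real" rule: linorder_cases)
    case less
    have "t \<le> w x / (- u x)" using t_le[of x] x less by (auto simp: G_def \<tau>_def)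
    then have "t * (- u x) \<le> w x" using less by (subst (asm) pos_le_divide_eq) auto
    moreover have "t * u x \<le> 0" using less t0 by (simp add: mult_le_0_iff)
    ultimately show ?thesis using frac[OF x] by auto
  next
    case equal
    then show ?thesis using frac[OF x] by simp
  next
    case greater
    have "t \<le> (1 - w x) / u x" using t_le[of x] x greater by (auto simp: G_def \<tau>_def)
    then have "t * u x \<le> 1 - w x" using greater by (simp add: pos_le_divide_eq)
    moreover have "t * u x \<ge> 0" using greater t0 by simp
    ultimately show ?thesis using frac[OF x] by auto
  qed
  moreover have "w z + t * u z = 0 \<or> w z + t * u z = 1"
    using z by (auto simp: \<tau>_def G_def)
  ultimately show ?thesis using z by (auto simp: G_def)
qed

text \<open>Only rows that contain a cell are constrained, so \<open>card (\<rho> ` X)\<close> is the number of rows.\<close>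

definition balanced ::
    "'i set \<Rightarrow> ('i \<Rightarrow> 'r) \<Rightarrow> ('i \<Rightarrow> 'a::real_vector) \<Rightarrow> real \<Rightarrow> ('i \<Rightarrow> real) \<Rightarrow> bool" where
  "balanced X \<rho> v p w \<longleftrightarrow> (\<forall>x\<in>X. 0 \<le> w x \<and> w x \<le> 1) \<and>
     (\<forall>r\<in>\<rho> ` X. (\<Sum>x\<in>{x\<in>X. \<rho> x = r}. w x) = p) \<and> (\<Sum>x\<in>X. w x *\<^sub>R v x) = 0"

definition supp_on :: "'i set \<Rightarrow> ('i \<Rightarrow> real) \<Rightarrow> 'i set" where
  "supp_on X w = {x\<in>X. w x \<noteq> 0}"

definition frac_on :: "'i set \<Rightarrow> ('i \<Rightarrow> real) \<Rightarrow> 'i set" where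
  "frac_on X w = {x\<in>X. 0 < w x \<and> w x < 1}"

text \<open>Balanced weights with the fewest fractional cells play the part of an extreme point. If
  they had more of them than claimed, moving along a dependence with zero row sums would keep
  them balanced until one more cell becomes \<open>0\<close> or \<open>1\<close>. Cells of weight \<open>0\<close> stay put, so the
  support cannot grow.\<close>

lemma balanced_few_fractional:
  fixes v :: "'i \<Rightarrow> 'a::euclidean_space" and \<rho> :: "'i \<Rightarrow> 'r"
  assumes fin: "finite X" and "balanced X \<rho> v p w"
  shows "\<exists>w'. balanced X \<rho> v p w' \<and> supp_on X w' \<subseteq> supp_on X w \<and>
           card (frac_on X w') \<le> card (\<rho> ` frac_on X w') + DIM('a)"
proof -
  define P where "P w' \<longleftrightarrow> balanced X \<rho> v p w' \<and> supp_on X w' \<subseteq> supp_on X w" for w'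
  have "P w" using assms(2) by (simp add: P_def)
  then obtain y where y: "P y" and min: "\<And>y'. P y' \<Longrightarrow> card (frac_on X y) \<le> card (frac_on X y')"
    using ex_has_least_nat[of P w "\<lambda>y. card (frac_on X y)"] by auto
  define F where "F = frac_on X y"
  have F: "finite F" "F \<subseteq> X" using fin by (auto simp: F_def frac_on_def)
  have bal: "balanced X \<rho> v p y" and sup: "supp_on X y \<subseteq> supp_on X w" using y by (auto simp: P_def)
  have "card F \<le> card (\<rho> ` F) + DIM('a)"
  proof (rule ccontr)
    assume "\<not> ?thesis"
    then obtain u where u: "\<exists>x\<in>F. u x \<noteq> 0" "\<And>r. (\<Sum>x\<in>{x\<in>F. \<rho> x = r}. u x) = 0"
        "(\<Sum>x\<in>F. u x *\<^sub>R v x) = 0"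
      using dependence_with_zero_row_sums[OF F(1), of \<rho> v] by (auto simp: not_le)
    obtain t where t: "\<And>x. x \<in> F \<Longrightarrow> 0 \<le> y x + t * u x \<and> y x + t * u x \<le> 1"
        "\<exists>x\<in>F. y x + t * u x = 0 \<or> y x + t * u x = 1"
      using move_to_boundary_of_cube[OF F(1), of y u] u(1) by (auto simp: F_def frac_on_def)
    define u' where "u' x = (if x \<in> F then u x else 0)" for x
    define y' where "y' x = y x + t * u' x" for x
    have u'sum: "(\<Sum>x\<in>{x\<in>X. \<rho> x = r}. u' x) = 0" for r
    proof -
      have "(\<Sum>x\<in>{x\<in>X. \<rho> x = r}. u' x) = (\<Sum>x\<in>{x\<in>F. \<rho> x = r}. u x)"
        using fin F by (intro sum.mono_neutral_cong_right) (auto simp: u'_def)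
      then show ?thesis using u(2) by simp
    qed
    have u'v: "(\<Sum>x\<in>X. u' x *\<^sub>R v x) = 0"
    proof -
      have "(\<Sum>x\<in>X. u' x *\<^sub>R v x) = (\<Sum>x\<in>F. u x *\<^sub>R v x)"
        using fin F by (intro sum.mono_neutral_cong_right) (auto simp: u'_def)
      then show ?thesis using u(3) by simp
    qed
    have "balanced X \<rho> v p y'"
      unfolding balanced_def
    proof (intro conjI ballI)
      fix x assume "x \<in> X"
      then show "0 \<le> y' x" "y' x \<le> 1"
        using bal t(1)[of x] by (auto simp: y'_def u'_def balanced_def)
    next
      fix r assume "r \<in> \<rho> ` X"
      then show "(\<Sum>x\<in>{x\<in>X. \<rho> x = r}. y' x) = p"
        using bal u'sum[of r]
        by (auto simp: y'_def sum.distrib balanced_def simp flip: sum_distrib_left)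
    next
      show "(\<Sum>x\<in>X. y' x *\<^sub>R v x) = 0"
        using bal u'v
        by (simp add: y'_def scaleR_add_left sum.distrib balanced_def flip: scaleR_scaleR scaleR_sum_right)
    qed
    moreover have "supp_on X y' \<subseteq> supp_on X w"
    proof -
      have "supp_on X y' \<subseteq> supp_on X y"
        by (auto simp: supp_on_def y'_def u'_def F_def frac_on_def split: if_splits)
      then show ?thesis using sup by blast
    qed
    ultimately have "P y'" by (simp add: P_def)
    moreover have "frac_on X y' \<subset> frac_on X y"
    proof -
      have "frac_on X y' \<subseteq> F"
        by (auto simp: F_def frac_on_def y'_def u'_def split: if_splits)
      moreover obtain z where "z \<in> F" "z \<notin> frac_on X y'"
        using t(2) by (auto simp: frac_on_def y'_def u'_def)
      ultimately show ?thesis by (auto simp: F_def)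
    qed
    then have "card (frac_on X y') < card (frac_on X y)"
      using F(1) by (intro psubset_card_mono) (auto simp: F_def)
    ultimately show False using min[of y'] by simp
  qed
  then show ?thesis using bal sup by (auto simp: F_def)
qed

lemma balanced_sum:
  assumes fin: "finite X" and "balanced X \<rho> v p w"
  shows "(\<Sum>x\<in>X. w x) = real (card (\<rho> ` X)) * p"
proof -
  have "(\<Sum>x\<in>X. w x) = (\<Sum>r\<in>\<rho> ` X. \<Sum>x\<in>{x\<in>X. \<rho> x = r}. w x)"
    using fin by (rule sum.image_gen)
  also have "\<dots> = (\<Sum>r\<in>\<rho> ` X. p)"
    using assms(2) by (intro sum.cong) (auto simp: balanced_def)
  finally show ?thesis by simp
qed

text \<open>Compare the number of cells in the support with its weight, row by row. Cells of weight
  \<open>1\<close> contribute no difference. In a row with fractional cells the difference is an integer,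
  because \<open>p\<close> is one, and it is strictly less than the number of fractional cells; so it is
  smaller by at least \<open>1\<close>. Summed over the rows, this gain cancels the term
  \<open>card (\<rho> ` frac_on X w)\<close>.\<close>

lemma support_of_few_fractional:
  fixes v :: "'i \<Rightarrow> 'a::euclidean_space" and \<rho> :: "'i \<Rightarrow> 'r"
  assumes fin: "finite X" and bal: "balanced X \<rho> v (real p) w"
    and few: "card (frac_on X w) \<le> card (\<rho> ` frac_on X w) + D"
  shows "card (supp_on X w) \<le> card (\<rho> ` X) * p + D"
proof -
  define F where "F = frac_on X w"
  define S where "S = supp_on X w"
  have FS: "finite F" "finite S" "F \<subseteq> S" "S \<subseteq> X"
    using fin by (auto simp: F_def S_def frac_on_def supp_on_def)
  have one: "w x = 1" if "x \<in> S - F" for x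
    using that bal by (force simp: S_def F_def frac_on_def supp_on_def balanced_def)
  have row: "(\<Sum>x\<in>{x\<in>F. \<rho> x = r}. 1 - w x) \<le> real (card {x\<in>F. \<rho> x = r}) - 1" if r: "r \<in> \<rho> ` F" for r
  proof -
    have "(\<Sum>x\<in>{x\<in>F. \<rho> x = r}. 1 - w x) = (\<Sum>x\<in>{x\<in>S. \<rho> x = r}. 1 - w x)"
      using FS one by (intro sum.mono_neutral_left) auto
    also have "\<dots> = real (card {x\<in>S. \<rho> x = r}) - (\<Sum>x\<in>{x\<in>S. \<rho> x = r}. w x)"
      by (simp add: sum_subtractf)
    also have "(\<Sum>x\<in>{x\<in>S. \<rho> x = r}. w x) = (\<Sum>x\<in>{x\<in>X. \<rho> x = r}. w x)"
      using fin FS by (intro sum.mono_neutral_left) (auto simp: S_def supp_on_def)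
    also have "\<dots> = real p"
      using r bal FS by (auto simp: balanced_def)
    finally have eq: "(\<Sum>x\<in>{x\<in>F. \<rho> x = r}. 1 - w x) = real (card {x\<in>S. \<rho> x = r}) - real p" .
    have "(\<Sum>x\<in>{x\<in>F. \<rho> x = r}. 1 - w x) < (\<Sum>x\<in>{x\<in>F. \<rho> x = r}. 1)"
      using r FS(1) by (intro sum_strict_mono finite_Collect_conjI disjI1)
        (auto simp: F_def frac_on_def)
    then have "real (card {x\<in>S. \<rho> x = r}) - real p < real (card {x\<in>F. \<rho> x = r})"
      using eq by simp
    then have "card {x\<in>S. \<rho> x = r} + 1 \<le> card {x\<in>F. \<rho> x = r} + p" by linarith
    then show ?thesis using eq by linarith
  qed
  have "real (card S) - real (card (\<rho> ` X)) * real p = (\<Sum>x\<in>S. 1 - w x)"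
  proof -
    have "(\<Sum>x\<in>S. w x) = (\<Sum>x\<in>X. w x)"
      using fin FS by (intro sum.mono_neutral_left) (auto simp: S_def supp_on_def)
    then show ?thesis using balanced_sum[OF fin bal] by (simp add: sum_subtractf)
  qed
  also have "\<dots> = (\<Sum>x\<in>F. 1 - w x)"
    using FS one by (intro sum.mono_neutral_right) auto
  also have "\<dots> = (\<Sum>r\<in>\<rho> ` F. \<Sum>x\<in>{x\<in>F. \<rho> x = r}. 1 - w x)"
    using FS(1) by (rule sum.image_gen)
  also have "\<dots> \<le> (\<Sum>r\<in>\<rho> ` F. real (card {x\<in>F. \<rho> x = r}) - 1)"
    by (rule sum_mono) (rule row)
  also have "\<dots> = real (card F) - real (card (\<rho> ` F))"
    using sum.image_gen[OF FS(1), of "\<lambda>_. 1::real" \<rho>] by (simp add: sum_subtractf)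
  also have "\<dots> \<le> real D" using few by (simp add: F_def)
  finally have "real (card S) \<le> real (card (\<rho> ` X) * p + D)" by simp
  then show ?thesis unfolding S_def of_nat_le_iff .
qed

text \<open>The weights for \<open>p - 1\<close> are an extreme point below the weights for \<open>p\<close>, scaled
  by \<open>(p - 1) / p\<close>: scaling keeps the weighted sum at \<open>0\<close> and the weights in \<open>[0, 1]\<close>.\<close>

lemma nested_balanced_weightings:
  fixes v :: "'i \<Rightarrow> 'a::euclidean_space" and \<rho> :: "'i \<Rightarrow> 'r"
  assumes fin: "finite X" and rows: "\<And>r. r \<in> \<rho> ` X \<Longrightarrow> card {x\<in>X. \<rho> x = r} = n"
    and zero: "(\<Sum>x\<in>X. v x) = 0"
  shows "\<exists>L. (\<forall>p\<le>n. balanced X \<rho> v (real p) (L p) \<and>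
                card (supp_on X (L p)) \<le> card (\<rho> ` X) * p + DIM('a)) \<and>
             (\<forall>p q. p \<le> q \<longrightarrow> q \<le> n \<longrightarrow> supp_on X (L p) \<subseteq> supp_on X (L q))"
proof -
  \<comment> \<open>The recursion runs upwards in \<open>q = n - p\<close>. Truncated subtraction makes it stay at row sum
    \<open>0\<close> once \<open>q \<ge> n\<close>, where the scaling factor \<open>c\<close> below is \<open>0 / 0 = 0\<close>.\<close>
  define P where "P q w \<longleftrightarrow> balanced X \<rho> v (real (n - q)) w \<and>
      card (supp_on X w) \<le> card (\<rho> ` X) * (n - q) + DIM('a)" for q w
  have "\<exists>f. \<forall>q. P q (f q) \<and> supp_on X (f (Suc q)) \<subseteq> supp_on X (f q)"
  proof (rule dependent_nat_choice)
    have "balanced X \<rho> v (real n) (\<lambda>_. 1)"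
      using rows zero by (simp add: balanced_def)
    moreover have "frac_on X (\<lambda>_. 1) = {}" by (simp add: frac_on_def)
    ultimately show "\<exists>w. P 0 w"
      using support_of_few_fractional[OF fin, of \<rho> v n "\<lambda>_. 1" "DIM('a)"]
      by (auto simp: P_def)
  next
    fix w q assume "P q w"
    then have bal: "balanced X \<rho> v (real (n - q)) w" by (simp add: P_def)
    define c where "c = real (n - Suc q) / real (n - q)"
    have c: "0 \<le> c" "c \<le> 1" "c * real (n - q) = real (n - Suc q)"
      by (auto simp: c_def divide_simps)
    have "balanced X \<rho> v (real (n - Suc q)) (\<lambda>x. c * w x)"
      using bal c
      by (auto simp: balanced_def mult_le_one simp flip: sum_distrib_left scaleR_scaleR scaleR_sum_right)
    from balanced_few_fractional[OF fin this] obtain w' where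
      w': "balanced X \<rho> v (real (n - Suc q)) w'" "supp_on X w' \<subseteq> supp_on X (\<lambda>x. c * w x)"
        "card (frac_on X w') \<le> card (\<rho> ` frac_on X w') + DIM('a)" by auto
    have "supp_on X (\<lambda>x. c * w x) \<subseteq> supp_on X w" by (auto simp: supp_on_def)
    then show "\<exists>w'. P (Suc q) w' \<and> supp_on X w' \<subseteq> supp_on X w"
      using w' support_of_few_fractional[OF fin w'(1,3)] by (auto simp: P_def)
  qed
  then obtain f where f: "\<And>q. P q (f q)" "\<And>q. supp_on X (f (Suc q)) \<subseteq> supp_on X (f q)" by blast
  have mono: "supp_on X (f b) \<subseteq> supp_on X (f a)" if "a \<le> b" for a b
    using that f(2) by (rule lift_Suc_antimono_le[of "\<lambda>q. supp_on X (f q)", rotated])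
  show ?thesis
  proof (intro exI[of _ "\<lambda>p. f (n - p)"] conjI allI impI)
    fix p assume "p \<le> n"
    then show "balanced X \<rho> v (real p) (f (n - p))"
      "card (supp_on X (f (n - p))) \<le> card (\<rho> ` X) * p + DIM('a)"
      using f(1)[of "n - p"] by (auto simp: P_def)
  next
    fix p q assume "p \<le> q" "q \<le> n"
    then show "supp_on X (f (n - p)) \<subseteq> supp_on X (f (n - q))" by (intro mono) auto
  qed
qed

section \<open>Ordering a row along a chain of sets\<close>

lemma permutation_sorting:
  fixes key :: "nat \<Rightarrow> nat"
  shows "\<exists>\<pi>. \<pi> permutes {1..n} \<and> (\<forall>i\<in>{1..n}. \<forall>j\<in>{1..n}. i \<le> j \<longrightarrow> key (\<pi> i) \<le> key (\<pi> j))"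
proof -
  define xs where "xs = sort_key key [1..<Suc n]"
  have xs: "length xs = n" "distinct xs" "set xs = {1..n}" "sorted (map key xs)"
    by (auto simp: xs_def)
  define \<pi> where "\<pi> i = (if i \<in> {1..n} then xs ! (i - 1) else i)" for i
  have "bij_betw (\<lambda>i. xs ! (i - 1)) {1..n} {1..n}"
  proof -
    have "bij_betw (\<lambda>i. i - 1) {1..n} {..<n}"
      by (rule bij_betw_byWitness[of _ Suc]) auto
    moreover have "bij_betw ((!) xs) {..<n} {1..n}"
      using xs by (intro bij_betw_nth) auto
    ultimately show ?thesis by (auto dest: bij_betw_trans simp: comp_def)
  qed
  then have "bij_betw \<pi> {1..n} {1..n}"
    by (rule bij_betw_cong[THEN iffD1, rotated]) (auto simp: \<pi>_def)
  then have "\<pi> permutes {1..n}" by (rule bij_imp_permutes) (auto simp: \<pi>_def)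
  moreover have "key (\<pi> i) \<le> key (\<pi> j)" if "i \<in> {1..n}" "j \<in> {1..n}" "i \<le> j" for i j
    using sorted_nth_mono[OF xs(4), of "i - 1" "j - 1"] that xs(1) by (auto simp: \<pi>_def)
  ultimately show ?thesis by blast
qed

text \<open>Sort the points by the number of members of the chain that miss them. Each member
  of the chain is then downward closed in this order, and so comparable with every
  initial segment. Comparing cardinalities then
  tells which of the two inclusions holds.\<close>

lemma permutation_following_chain:
  fixes \<S> :: "nat set set"
  assumes fin: "finite \<S>" and chain: "\<And>S T. S \<in> \<S> \<Longrightarrow> T \<in> \<S> \<Longrightarrow> S \<subseteq> T \<or> T \<subseteq> S"
    and sub: "\<And>S. S \<in> \<S> \<Longrightarrow> S \<subseteq> {1..n}"
  shows "\<exists>\<pi>. \<pi> permutes {1..n} \<and> (\<forall>S\<in>\<S>. \<forall>m\<le>n. \<pi> ` {1..m} \<subseteq> S \<or> S \<subseteq> \<pi> ` {1..m})"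
proof -
  define key where "key x = card {S\<in>\<S>. x \<notin> S}" for x
  have key: "y \<in> S" if "key y \<le> key x" "x \<in> S" "S \<in> \<S>" for x y S
  proof (rule ccontr)
    assume "y \<notin> S"
    then have "{T\<in>\<S>. x \<notin> T} \<subset> {T\<in>\<S>. y \<notin> T}"
      using that chain[of S] by blast
    then have "key x < key y"
      unfolding key_def using fin by (intro psubset_card_mono) auto
    then show False using that by simp
  qed
  obtain \<pi> where \<pi>: "\<pi> permutes {1..n}"
      "\<And>i j. i \<in> {1..n} \<Longrightarrow> j \<in> {1..n} \<Longrightarrow> i \<le> j \<Longrightarrow> key (\<pi> i) \<le> key (\<pi> j)"
    using permutation_sorting[of n key] by auto
  have "\<pi> ` {1..m} \<subseteq> S" if S: "S \<in> \<S>" "m \<le> n" and ne: "\<not> S \<subseteq> \<pi> ` {1..m}" for S m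
  proof -
    obtain x where x: "x \<in> S" "x \<notin> \<pi> ` {1..m}" using ne by blast
    then have "x \<in> \<pi> ` {1..n}" using sub[OF S(1)] permutes_image[OF \<pi>(1)] by auto
    then obtain j where j: "j \<in> {1..n}" "x = \<pi> j" by auto
    then have "m < j" using x by (auto simp: not_le[symmetric])
    then show ?thesis using key[of _ x S] x S \<pi>(2)[of _ j] j by auto
  qed
  then show ?thesis using \<pi>(1) by blast
qed

section \<open>Rounding balanced weights to a set of cells\<close>

text \<open>This is the triangle inequality, obtained in one step from convexity and symmetry: after
  division by the sum of the \<open>\<bar>c x\<bar>\<close> the left-hand vector is a convex combination of the
  points \<open>v x\<close> and \<open>- v x\<close>.\<close>

lemma body_norm_weighted_sum_le:
  fixes K :: "(real ^ 'd) set"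
  assumes K: "symmetric_convex_body K" and fin: "finite X" and v: "\<And>x. x \<in> X \<Longrightarrow> v x \<in> K"
  shows "body_norm K (\<Sum>x\<in>X. c x *\<^sub>R v x) \<le> (\<Sum>x\<in>X. \<bar>c x\<bar>)"
proof -
  define T where "T = (\<Sum>x\<in>X. \<bar>c x\<bar>)"
  have T0: "T \<ge> 0" by (simp add: T_def sum_nonneg)
  have "(\<Sum>x\<in>X. c x *\<^sub>R v x) \<in> (\<lambda>y. T *\<^sub>R y) ` K"
  proof (cases "T = 0")
    case True
    then have "c x = 0" if "x \<in> X" for x
      using that fin by (simp add: T_def sum_nonneg_eq_0_iff)
    then have "(\<Sum>x\<in>X. c x *\<^sub>R v x) = 0" by simp
    moreover have "0 \<in> K" using symmetric_convex_body_zero_interior[OF K] interior_subset by blast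
    ultimately show ?thesis by (intro image_eqI[of _ _ 0]) auto
  next
    case False
    have neg: "- y \<in> K" if "y \<in> K" for y
      using K that by (auto simp: symmetric_convex_body_def)
    have mem: "(\<Sum>x\<in>X. (\<bar>c x\<bar> / T) *\<^sub>R (if c x \<ge> 0 then v x else - v x)) \<in> K"
    proof (rule convex_sum[OF fin])
      show "convex K" using K by (simp add: symmetric_convex_body_def)
      show "(\<Sum>x\<in>X. \<bar>c x\<bar> / T) = 1"
        using False by (simp add: T_def flip: sum_divide_distrib)
    qed (use T0 v neg in auto)
    have "T *\<^sub>R (\<Sum>x\<in>X. (\<bar>c x\<bar> / T) *\<^sub>R (if c x \<ge> 0 then v x else - v x))
        = (\<Sum>x\<in>X. c x *\<^sub>R v x)"
      unfolding scaleR_sum_right using False by (intro sum.cong) auto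
    from image_eqI[where f = "\<lambda>y. T *\<^sub>R y", OF this[symmetric] mem] show ?thesis .
  qed
  from body_norm_attained(2)[OF K T0 this] show ?thesis unfolding T_def .
qed

text \<open>Subtracting the weights \<open>w\<close> from the indicator of \<open>V\<close> does not change the sum of vectors,
  since the part subtracted is \<open>0\<close>.\<close>

lemma body_norm_sum_le_distance_to_balanced:
  fixes K :: "(real ^ 'd) set"
  assumes K: "symmetric_convex_body K" and fin: "finite X" and v: "\<And>x. x \<in> X \<Longrightarrow> v x \<in> K"
    and "balanced X \<rho> v p w" and "V \<subseteq> X"
  shows "body_norm K (\<Sum>x\<in>V. v x) \<le> (\<Sum>x\<in>X. \<bar>indicator V x - w x\<bar>)"
proof -
  have "(\<Sum>x\<in>X. (indicator V x - w x) *\<^sub>R v x) = (\<Sum>x\<in>X. indicator V x *\<^sub>R v x)"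
    using assms(4) by (simp add: balanced_def scaleR_diff_left sum_subtractf)
  also have "\<dots> = (\<Sum>x\<in>V. v x)"
    using fin assms(5) by (intro sum.mono_neutral_cong_right) auto
  finally show ?thesis
    using body_norm_weighted_sum_le[OF K fin, where v = v and c = "\<lambda>x. indicator V x - w x"] v by simp
qed

lemma sum_indicator_real:
  assumes "finite X" "V \<subseteq> X"
  shows "(\<Sum>x\<in>X. indicator V x) = real (card V)"
proof -
  have "(\<Sum>x\<in>X. indicator V x) = (\<Sum>x\<in>V. 1::real)"
    using assms by (intro sum.mono_neutral_cong_right) auto
  then show ?thesis by simp
qed

text \<open>Both \<open>w\<close> and the indicator of \<open>V\<close> lie below the indicator of the support, and their
  distance is estimated by going through it.\<close>

lemma distance_to_balanced_superset:
  assumes fin: "finite X" and bal: "balanced X \<rho> v p w" and V: "V \<subseteq> supp_on X w"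
  shows "(\<Sum>x\<in>X. \<bar>indicator V x - w x\<bar>)
    \<le> 2 * real (card (supp_on X w)) - real (card V) - real (card (\<rho> ` X)) * p"
proof -
  let ?S = "supp_on X w"
  have SX: "?S \<subseteq> X" by (auto simp: supp_on_def)
  have "(\<Sum>x\<in>X. \<bar>indicator V x - w x\<bar>)
      \<le> (\<Sum>x\<in>X. (indicator ?S x - indicator V x) + (indicator ?S x - w x))"
    using bal V by (intro sum_mono) (auto simp: balanced_def supp_on_def indicator_def)
  also have "\<dots> = 2 * real (card ?S) - real (card V) - real (card (\<rho> ` X)) * p"
    using sum_indicator_real[OF fin SX] sum_indicator_real[OF fin order_trans[OF V SX]]
      balanced_sum[OF fin bal]
    unfolding sum.distrib sum_subtractf by linarith
  finally show ?thesis .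
qed

lemma distance_to_balanced_subset:
  assumes fin: "finite X" and bal: "balanced X \<rho> v p w" and V: "supp_on X w \<subseteq> V" "V \<subseteq> X"
  shows "(\<Sum>x\<in>X. \<bar>indicator V x - w x\<bar>) = real (card V) - real (card (\<rho> ` X)) * p"
proof -
  have "(\<Sum>x\<in>X. \<bar>indicator V x - w x\<bar>) = (\<Sum>x\<in>X. indicator V x - w x)"
    using bal V by (intro sum.cong) (auto simp: balanced_def supp_on_def indicator_def)
  then show ?thesis
    using sum_indicator_real[OF fin V(2)] balanced_sum[OF fin bal] by (simp add: sum_subtractf)
qed

section \<open>Bounding the column prefix sums\<close>

theorem theorem1p3:
  fixes K :: "(real ^ 'd) set" and A :: "nat \<Rightarrow> nat \<Rightarrow> real ^ 'd" and k n :: nat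
  assumes "k \<ge> 1" and "n \<ge> 1"
    and "symmetric_convex_body K"
    and "\<And>j i. j \<in> {1..k} \<Longrightarrow> i \<in> {1..n} \<Longrightarrow> A j i \<in> K"
    and "(\<Sum>j = 1..k. \<Sum>i = 1..n. A j i) = 0"
  shows "\<exists>C. row_permuted_copy k n A C \<and>
           (\<forall>m\<in>{1..n}. body_norm K (\<Sum>j = 1..k. \<Sum>i = 1..m. C j i)
              \<le> min (real CARD('d) * real k) (4 * real CARD('d) - 2))"
proof -
  define X where "X = {1..k} \<times> {1..n}"
  define v where "v = (\<lambda>(j, i). A j i)"
  let ?d = "CARD('d)"
  have fin: "finite X" by (simp add: X_def)
  have img: "fst ` X = {1..k}" using \<open>n \<ge> 1\<close> by (force simp: X_def)
  have row: "{x\<in>X. fst x = j} = Pair j ` {1..n}" if "j \<in> {1..k}" for j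
    using that by (auto simp: X_def)
  have cell: "v x \<in> K" if "x \<in> X" for x using that assms(4) by (auto simp: X_def v_def)
  have zero: "(\<Sum>x\<in>X. v x) = 0"
    using assms(5) by (simp add: X_def v_def sum.cartesian_product)
  have "card {x\<in>X. fst x = r} = n" if "r \<in> fst ` X" for r
    using that row[of r] unfolding img by (simp add: card_image inj_on_def)
  from nested_balanced_weightings[OF fin this zero] obtain L where
    bal: "\<And>p. p \<le> n \<Longrightarrow> balanced X fst v (real p) (L p)" and
    supp: "\<And>p. p \<le> n \<Longrightarrow> card (supp_on X (L p)) \<le> k * p + ?d" and
    nest: "\<And>p q. p \<le> q \<Longrightarrow> q \<le> n \<Longrightarrow> supp_on X (L p) \<subseteq> supp_on X (L q)"
    unfolding img by auto
  define S where "S j p = {i. (j, i) \<in> supp_on X (L p)}" for j p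
  have S: "supp_on X (L p) = Sigma {1..k} (\<lambda>j. S j p)" for p
    by (auto simp: S_def supp_on_def X_def)
  have Sn: "S j p \<subseteq> {1..n}" for j p by (auto simp: S_def supp_on_def X_def)
  have finS: "finite (S j p)" for j p using Sn finite_subset by blast
  have cardS: "card (supp_on X (L p)) = (\<Sum>j=1..k. card (S j p))" for p
    unfolding S using finS by (subst card_SigmaI) auto
  have S_ge: "p \<le> card (S j p)" if p: "p \<le> n" and j: "j \<in> {1..k}" for j p
  proof -
    have "real p = (\<Sum>x\<in>{x\<in>X. fst x = j}. L p x)"
      using bal[OF p] j img by (simp add: balanced_def)
    also have "\<dots> = (\<Sum>i=1..n. L p (j, i))"
      unfolding row[OF j] by (simp add: sum.reindex inj_on_def)
    also have "\<dots> = (\<Sum>i\<in>S j p. L p (j, i))"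
      using Sn j by (intro sum.mono_neutral_right) (auto simp: S_def supp_on_def X_def)
    also have "\<dots> \<le> (\<Sum>i\<in>S j p. 1)"
      using bal[OF p] by (intro sum_mono) (auto simp: balanced_def S_def supp_on_def)
    finally show ?thesis by simp
  qed
  \<comment> \<open>All other rows have at least \<open>p\<close> cells in the support, so the surplus of \<open>d\<close> cells
    bounds the surplus of each single row.\<close>
  have S_le: "card (S j p) \<le> p + ?d" if p: "p \<le> n" and j: "j \<in> {1..k}" for j p
  proof -
    have "(\<Sum>j'\<in>{1..k} - {j}. p) \<le> (\<Sum>j'\<in>{1..k} - {j}. card (S j' p))"
      using S_ge[OF p] by (intro sum_mono) auto
    then have "card (S j p) + (k - 1) * p \<le> k * p + ?d"
      using supp[OF p] j unfolding cardS by (simp add: sum.remove[of _ j] card_Diff_singleton)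
    moreover have "k * p = (k - 1) * p + p" using \<open>k \<ge> 1\<close> by (cases k) auto
    ultimately show ?thesis by linarith
  qed
  have S_0: "S j 0 = {}" for j
  proof -
    have "(\<Sum>x\<in>X. L 0 x) = 0" using balanced_sum[OF fin bal[of 0]] by simp
    then have "L 0 x = 0" if "x \<in> X" for x
      using that fin bal[of 0] by (subst (asm) sum_nonneg_eq_0_iff) (auto simp: balanced_def)
    then show ?thesis by (auto simp: S_def supp_on_def)
  qed
  have "\<exists>\<pi>. \<pi> permutes {1..n} \<and> (\<forall>T\<in>S j ` {..n}. \<forall>m\<le>n. \<pi> ` {1..m} \<subseteq> T \<or> T \<subseteq> \<pi> ` {1..m})" for j
  proof (rule permutation_following_chain)
    fix T T' assume "T \<in> S j ` {..n}" "T' \<in> S j ` {..n}"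
    then obtain p q where pq: "T = S j p" "T' = S j q" "p \<le> n" "q \<le> n" by auto
    show "T \<subseteq> T' \<or> T' \<subseteq> T"
      using nest[of p q] nest[of q p] pq by (cases "p \<le> q") (auto simp: S_def)
  qed (use Sn in auto)
  then obtain \<pi> where perm: "\<And>j. \<pi> j permutes {1..n}" and
    comp: "\<And>j p m. p \<le> n \<Longrightarrow> m \<le> n \<Longrightarrow> \<pi> j ` {1..m} \<subseteq> S j p \<or> S j p \<subseteq> \<pi> j ` {1..m}"
    by (metis atMost_iff image_eqI)
  have inj: "inj_on (\<pi> j) B" for j B
    using perm permutes_inj inj_on_subset by blast
  have card\<pi>: "card (\<pi> j ` {1..m}) = m" for j m
    using inj by (simp add: card_image)
  define C where "C j i = A j (\<pi> j i)" for j i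
  have copy: "row_permuted_copy k n A C"
    unfolding row_permuted_copy_def C_def using perm by (intro exI[of _ \<pi>]) simp
  have "body_norm K (\<Sum>j = 1..k. \<Sum>i = 1..m. C j i)
          \<le> min (real ?d * real k) (4 * real ?d - 2)" if m: "m \<in> {1..n}" for m
  proof -
    have mn: "m \<le> n" using m by simp
    define V where "V = Sigma {1..k} (\<lambda>j. \<pi> j ` {1..m})"
    have "\<pi> j ` {1..m} \<subseteq> {1..n}" for j
      using permutes_image[OF perm[of j]] mn by (metis atLeastatMost_subset_iff image_mono order_refl)
    then have VX: "V \<subseteq> X" by (auto simp: V_def X_def)
    have cardV: "card V = k * m" by (simp add: V_def card\<pi> del: One_nat_def)
    have sumV: "(\<Sum>j = 1..k. \<Sum>i = 1..m. C j i) = (\<Sum>x\<in>V. v x)"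
      unfolding V_def v_def by (subst sum.Sigma[symmetric]) (auto simp: C_def sum.reindex[OF inj])
    have bound: "body_norm K (\<Sum>j = 1..k. \<Sum>i = 1..m. C j i) \<le> (\<Sum>x\<in>X. \<bar>indicator V x - L q x\<bar>)"
      if "q \<le> n" for q
      unfolding sumV
      by (rule body_norm_sum_le_distance_to_balanced[OF assms(3) fin _ bal[OF that] VX]) (rule cell)
    \<comment> \<open>Every row of the support of \<open>L m\<close> has at least \<open>m\<close> cells, as weights are at most \<open>1\<close>.\<close>
    have "V \<subseteq> supp_on X (L m)"
    proof -
      have "\<pi> j ` {1..m} \<subseteq> S j m" if "j \<in> {1..k}" for j
        using comp[OF mn mn, of j]
      proof
        assume sub: "S j m \<subseteq> \<pi> j ` {1..m}"
        have "S j m = \<pi> j ` {1..m}"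
          using S_ge[OF mn that] by (intro card_seteq[OF _ sub]) (simp_all add: card\<pi> del: One_nat_def)
        then show ?thesis by simp
      qed
      then show ?thesis unfolding V_def S by (intro Sigma_mono) auto
    qed
    from distance_to_balanced_superset[OF fin bal[OF mn] this]
    have "(\<Sum>x\<in>X. \<bar>indicator V x - L m x\<bar>) \<le> 2 * real (card (supp_on X (L m))) - 2 * (real k * real m)"
      by (simp add: cardV img)
    also have "\<dots> \<le> 2 * real ?d"
      using supp[OF mn] of_nat_mono[of "card (supp_on X (L m))" "k * m + ?d", where 'a = real] by simp
    finally have two_d: "body_norm K (\<Sum>j = 1..k. \<Sum>i = 1..m. C j i) \<le> 2 * real ?d"
      using bound[OF mn] by linarith
    \<comment> \<open>Shifting the row sums down by \<open>d\<close> makes the support fit into the first \<open>m\<close> columns. For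
      \<open>m < d\<close> truncation gives \<open>p = 0\<close>, where the support is empty.\<close>
    define p where "p = m - ?d"
    have pn: "p \<le> n" using mn by (simp add: p_def)
    have "S j p \<subseteq> \<pi> j ` {1..m}" if j: "j \<in> {1..k}" for j
      using comp[OF pn mn, of j]
    proof
      assume sub: "\<pi> j ` {1..m} \<subseteq> S j p"
      have "card (S j p) \<le> m"
        using S_le[OF pn j] S_0 by (cases "p = 0") (auto simp: p_def)
      then have "\<pi> j ` {1..m} = S j p"
        using finS by (intro card_seteq[OF _ sub]) (simp_all add: card\<pi> del: One_nat_def)
      then show ?thesis by simp
    qed
    then have "supp_on X (L p) \<subseteq> V" unfolding V_def S by (intro Sigma_mono) auto
    from distance_to_balanced_subset[OF fin bal[OF pn] this VX]
    have "(\<Sum>x\<in>X. \<bar>indicator V x - L p x\<bar>) = real k * (real m - real p)"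
      by (simp add: cardV img algebra_simps)
    also have "\<dots> \<le> real k * real ?d" by (intro mult_left_mono) (auto simp: p_def)
    finally have d_k: "body_norm K (\<Sum>j = 1..k. \<Sum>i = 1..m. C j i) \<le> real ?d * real k"
      using bound[OF pn] by (simp add: mult.commute)
    have "real ?d \<ge> 1" by (simp add: Suc_leI)
    then have "2 * real ?d \<le> 4 * real ?d - 2" by linarith
    then show ?thesis using two_d d_k by (intro min.boundedI) linarith+
  qed
  then show ?thesis using copy by blast
qed

end
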